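(* Let $\Gamma$ be a holomorphic correspondence on $\widehat{\mathbb{C}}$ with associated set-valued map $\digamma$. Suppose $\mu \in \mathscr{E}^{\Gamma}$ is a $\digamma^{*}$-invariant measure which does not put any mass on polar sets. Let $E \subseteq \widehat{\mathbb{C}}$ be a Borel set with $\mu(E) > 0$. Then the first forward return time $\mathfrak{n}_{E}$ satisfies $$\int_{E} \mathfrak{n}_{E}(z)\, \mathrm{d}\mu_{E}(z) \ \le\ \frac{1}{\mu(E)},$$ where $\mu_{E}(E') = \dfrac{\mu(E \cap E')}{\mu(E)}$ for any Borel subset $E' \subseteq \widehat{\mathbb{C}}$.
   Context: A holomorphic correspondence on $\widehat{\mathbb{C}}$ is a formal sum $\Gamma = \sum_{\alpha=1}^{N} m_{\alpha}\Gamma_{\alpha}$, where the $m_\alpha$ are positive integers and the $\Gamma_\alpha \subseteq \widehat{\mathbb{C}}\times\widehat{\mathbb{C}}$ are distinct irreducible complex-analytic subvarieties of dimension $1$ such that, with $\pi_1,\pi_2$ the coordinate projections, each $\pi_i|_{\Gamma_\alpha}$ is surjective ($i=1,2$) and, for every $\alpha$ and any generic $z_0$, the sets $\pi_1(\pi_2^{-1}(\{z_0\})\cap\Gamma_\alpha)$ and $\pi_2(\pi_1^{-1}(\{z_0\})\cap\Gamma_\alpha)$ are finite. The support is $|\Gamma| = \bigcup_\alpha \Gamma_\alpha$. The associated set-valued map $\digamma$ is $\digamma(z)=\{w : (z,w)\in|\Gamma|\}$ and $\digamma^{\dagger}(z)=\{w : (w,z)\in|\Gamma|\}$ is the set of pre-images;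 images and pre-images are counted with multiplicity (in particular in sums). The topological degree $d_{\mathrm{top}}$ is the number of pre-images, counted with multiplicity, of a generic point. For sets, $\digamma(A)=\bigcup_{z\in A}\digamma(z)$ and $\digamma^\dagger(A)=\bigcup_{z\in A}\digamma^\dagger(z)$. For $p\ge 1$, $\digamma^{p}$ is the set-valued map of the $p$-fold composition $\Gamma^{\circ p}$; as a set, $\digamma^p(z)$ is the $p$-fold iterate of $\digamma$ applied to $z$. $\mathscr{M}(\widehat{\mathbb{C}})$ is the set of Borel probability measures on $\widehat{\mathbb{C}}$. $\mu\in\mathscr{M}(\widehat{\mathbb{C}})$ is $\digamma^{*}$-invariant if $\int f\,\mathrm{d}\mu = \frac{1}{d_{\mathrm{top}}}\int \sum_{w\in\digamma^{\dagger}(z)} f(w)\,\mathrm{d}\mu(z)$ for all $f\in\mathcal{C}(\widehat{\mathbb{C}},\mathbb{R})$. Orbit space: $\mathscr{O}^{\Gamma}(\widehat{\mathbb{C}})$ is the set of pairs of bi-infinite sequences $((z_n)_{n\in\mathbb{Z}};(\gamma_n)_{n\in\mathbb{Z}})$ with $z_n\in\widehat{\mathbb{C}}$, $\gamma_n\in\{1,\dots,N\}$ and $(z_{n-1},z_n)\in\Gamma_{\gamma_n}$ for all $n\in\mathbb{Z}$. It is a compact metric space with the metric that is the maximum of $\sup_{n\in\mathbb{Z}}2^{-|n|}\rho(z_n,w_n)$ ($\rho$ the spherical metric) and $\sup_{n\ge1}2^{-n}\max\{1-\delta_{(\gamma_n,\gamma'_n)},\,1-\delta_{(\gamma_{1-n},\gamma'_{1-n})}\}$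 ($\delta$ the Kronecker delta) between points $((z_n);(\gamma_n))$ and $((w_n);(\gamma'_n))$. The shift $\sigma^{\Gamma}$ sends $((z_n);(\gamma_n))$ to $((z_{n+1});(\gamma_{n+1}))$ and is a homeomorphism. $\Pi_0((z_n);(\gamma_n))=z_0$. $\mathscr{M}_{\sigma^\Gamma}(\mathscr{O}^{\Gamma}(\widehat{\mathbb{C}}))$ is the set of $\sigma^\Gamma$-invariant Borel probability measures on $\mathscr{O}^{\Gamma}(\widehat{\mathbb{C}})$, and $$\mathscr{E}^{\Gamma}=\{\mu\in\mathscr{M}(\widehat{\mathbb{C}}) : \mu=(\Pi_0)_*\mathcal{M}\text{ for some }\sigma^\Gamma\text{-ergodic }\mathcal{M}\in\mathscr{M}_{\sigma^\Gamma}(\mathscr{O}^{\Gamma}(\widehat{\mathbb{C}}))\}.$$ The first forward return time of $z\in E$ to $E$ is $\mathfrak{n}_E(z)=\min\{p\in\mathbb{Z}_+ (p\ge1): \digamma^p(z)\cap E\ne\emptyset\}$; by the known recurrence theorem for correspondences it is finite for $\mu$-almost every $z\in E$. *)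

theory Defs
  imports "HOL-Probability.Probability"
begin

section \<open>The Riemann sphere\<close>

datatype riemann_sphere = Fin complex | Infty

text \<open>Stereographic projection from the north pole onto the unit sphere of
  \<open>complex \<times> real\<close>, that is, of Euclidean 3-space.\<close>

fun stereo :: "riemann_sphere \<Rightarrow> complex \<times> real" where
  "stereo (Fin z) =
     ((2 / (1 + (cmod z)\<^sup>2)) *\<^sub>R z, ((cmod z)\<^sup>2 - 1) / ((cmod z)\<^sup>2 + 1))"
| "stereo Infty = (0, 1)"

lemma norm_stereo: "norm (stereo x) = 1"
proof (cases x)
  case (Fin z)
  define s where "s = (cmod z)\<^sup>2"
  have s: "s \<ge> 0" by (simp add: s_def)
  have "norm (stereo x) = sqrt ((2 / (1 + s) * cmod z)\<^sup>2 + ((s - 1) / (s + 1))\<^sup>2)"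
    using s by (simp add: Fin norm_prod_def s_def power_divide)
  also have "(2 / (1 + s) * cmod z)\<^sup>2 = 4 * s / (1 + s)\<^sup>2"
    by (simp add: power_mult_distrib power_divide s_def)
  also have "4 * s / (1 + s)\<^sup>2 + ((s - 1) / (s + 1))\<^sup>2 = 1"
    using s by (simp add: power_divide add.commute[of 1 s] add_divide_distrib[symmetric])
       (simp add: divide_simps power2_eq_square algebra_simps)
  finally show ?thesis by simp
qed (simp add: norm_prod_def)

lemma stereo_inject: "stereo x = stereo y \<longleftrightarrow> x = y"
proof
  assume eq: "stereo x = stereo y"
  have lt: "(s - 1) / (s + 1) < 1" if "s \<ge> 0" for s :: real
    using that by (simp add: divide_simps)
  have inj: "s = t" if "(s - 1) / (s + 1) = (t - 1) / (t + 1)" "s \<ge> 0" "t \<ge> 0" for s t :: real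
    using that by (simp add: divide_simps) (simp add: algebra_simps)
  show "x = y"
  proof (cases x; cases y)
    fix z w assume xy: "x = Fin z" "y = Fin w"
    have s: "(cmod z)\<^sup>2 = (cmod w)\<^sup>2"
      using eq inj[of "(cmod z)\<^sup>2" "(cmod w)\<^sup>2"] by (simp add: xy)
    moreover have "2 / (1 + (cmod w)\<^sup>2) \<noteq> 0"
      by (smt (verit) divide_eq_0_iff zero_le_power2)
    ultimately show ?thesis using eq by (simp add: xy)
  next
    fix z assume "x = Fin z" "y = Infty"
    then show ?thesis using eq lt[of "(cmod z)\<^sup>2"] by simp
  next
    fix z assume "x = Infty" "y = Fin z"
    then show ?thesis using eq lt[of "(cmod z)\<^sup>2"] by simp
  qed auto
qed auto

lemma arccos_inner_triangle:
  fixes x y z :: "'a :: real_inner"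
  assumes "norm x = 1" "norm y = 1" "norm z = 1"
  shows "arccos (x \<bullet> z) \<le> arccos (x \<bullet> y) + arccos (y \<bullet> z)"
proof -
  have b: "\<bar>u \<bullet> v\<bar> \<le> 1" if "norm u = 1" "norm v = 1" for u v :: 'a
    using Cauchy_Schwarz_ineq2[of u v] that by simp
  define a c where "a = arccos (x \<bullet> y)" and "c = arccos (y \<bullet> z)"
  have ca: "cos a = x \<bullet> y" "cos c = y \<bullet> z"
    using b assms by (auto simp: a_def c_def intro!: cos_arccos_abs)
  have ra: "0 \<le> a" "a \<le> pi" "0 \<le> c" "c \<le> pi"
    using b assms
    by (auto simp: a_def c_def abs_le_iff minus_le_iff intro!: arccos_lbound arccos_ubound)
  have xx: "x \<bullet> x = 1" "y \<bullet> y = 1" "z \<bullet> z = 1"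
    using assms by (auto simp: norm_eq_1)
  have n: "norm (x - (x \<bullet> y) *\<^sub>R y) = sin a" "norm (z - (y \<bullet> z) *\<^sub>R y) = sin c"
  proof -
    have "(norm (x - (x \<bullet> y) *\<^sub>R y))\<^sup>2 = 1 - (x \<bullet> y)\<^sup>2"
      unfolding power2_norm_eq_inner
      by (simp add: inner_diff_left inner_diff_right xx inner_commute[of y x] power2_eq_square)
    also have "\<dots> = (sin a)\<^sup>2" by (simp add: sin_squared_eq ca)
    finally show "norm (x - (x \<bullet> y) *\<^sub>R y) = sin a"
      using sin_ge_zero[OF ra(1,2)] by simp
    have "(norm (z - (y \<bullet> z) *\<^sub>R y))\<^sup>2 = 1 - (y \<bullet> z)\<^sup>2"
      unfolding power2_norm_eq_inner
      by (simp add: inner_diff_left inner_diff_right xx inner_commute[of z y] power2_eq_square)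
    also have "\<dots> = (sin c)\<^sup>2" by (simp add: sin_squared_eq ca)
    finally show "norm (z - (y \<bullet> z) *\<^sub>R y) = sin c"
      using sin_ge_zero[OF ra(3,4)] by simp
  qed
  have "(x - (x \<bullet> y) *\<^sub>R y) \<bullet> (z - (y \<bullet> z) *\<^sub>R y) = x \<bullet> z - (x \<bullet> y) * (y \<bullet> z)"
    by (simp add: inner_diff_left inner_diff_right xx)
  moreover have "\<bar>(x - (x \<bullet> y) *\<^sub>R y) \<bullet> (z - (y \<bullet> z) *\<^sub>R y)\<bar> \<le> sin a * sin c"
    using Cauchy_Schwarz_ineq2[of "x - (x \<bullet> y) *\<^sub>R y" "z - (y \<bullet> z) *\<^sub>R y"] n by simp
  ultimately have le: "cos (a + c) \<le> x \<bullet> z"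
    by (simp add: cos_add ca)
  have "arccos (x \<bullet> z) \<le> a + c"
  proof (cases "a + c \<le> pi")
    case True
    have "arccos (x \<bullet> z) \<le> arccos (cos (a + c))"
      using le b[OF assms(1,3)] by (intro arccos_le_arccos) auto
    then show ?thesis using True ra by (simp add: arccos_cos)
  next
    case False
    then show ?thesis using arccos_ubound[of "x \<bullet> z"] b[OF assms(1,3)] by (auto simp: abs_le_iff)
  qed
  then show ?thesis by (simp add: a_def c_def)
qed

text \<open>\<open>dist\<close> is the spherical (geodesic) distance.\<close>

instantiation riemann_sphere :: metric_space
begin

definition dist_riemann_sphere :: "riemann_sphere \<Rightarrow> riemann_sphere \<Rightarrow> real" where
  "dist x y = arccos (stereo x \<bullet> stereo y)"

definition uniformity_riemann_sphere :: "(riemann_sphere \<times> riemann_sphere) filter" where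
  "uniformity = (INF e\<in>{0<..}. principal {(x :: riemann_sphere, y). dist x y < e})"

definition open_riemann_sphere :: "riemann_sphere set \<Rightarrow> bool" where
  "open (U :: riemann_sphere set) \<longleftrightarrow> (\<forall>x\<in>U. \<forall>\<^sub>F (x', y) in uniformity. x' = x \<longrightarrow> y \<in> U)"

instance
proof
  fix x y z :: riemann_sphere
  show "dist x y = 0 \<longleftrightarrow> x = y"
  proof
    assume "dist x y = 0"
    then have "cos (arccos (stereo x \<bullet> stereo y)) = 1"
      by (simp add: dist_riemann_sphere_def)
    then have "stereo x \<bullet> stereo y = 1"
      using Cauchy_Schwarz_ineq2[of "stereo x" "stereo y"]
      by (simp add: norm_stereo cos_arccos_abs)
    then have "(norm (stereo x - stereo y))\<^sup>2 = 0"
      by (simp add: power2_norm_eq_inner inner_diff_left inner_diff_right inner_commute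
          norm_stereo[unfolded norm_eq_1])
    then show "x = y" by (simp add: stereo_inject)
  qed (simp add: dist_riemann_sphere_def norm_stereo[unfolded norm_eq_1])
  show "dist x y \<le> dist x z + dist y z"
    using arccos_inner_triangle[of "stereo x" "stereo z" "stereo y"]
    by (simp add: dist_riemann_sphere_def norm_stereo inner_commute)
qed (simp_all add: uniformity_riemann_sphere_def open_riemann_sphere_def)

end

lemma dist_riemann_sphere_le_pi: "dist (x :: riemann_sphere) y \<le> pi"
  using Cauchy_Schwarz_ineq2[of "stereo x" "stereo y"]
  by (auto simp: dist_riemann_sphere_def norm_stereo abs_le_iff intro!: arccos_ubound)

text \<open>The two standard holomorphic parametrizations, \<open>z \<mapsto> z\<close> and \<open>z \<mapsto> 1/z\<close>; they are the
  inverses of the two charts of the standard complex atlas.\<close>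

definition inv_param :: "complex \<Rightarrow> riemann_sphere" where
  "inv_param z = (if z = 0 then Infty else Fin (1 / z))"

definition sphere_params :: "(complex \<Rightarrow> riemann_sphere) set" where
  "sphere_params = {Fin, inv_param}"


section \<open>Analytic subvarieties of the product of two spheres\<close>

definition holomorphic2_on :: "(complex \<times> complex) set \<Rightarrow> (complex \<times> complex \<Rightarrow> complex) \<Rightarrow> bool" where
  "holomorphic2_on W f \<longleftrightarrow>
     open W \<and> (\<forall>p\<in>W. \<exists>a b. (f has_derivative (\<lambda>(h, k). a * h + b * k)) (at p))"

definition biholomorphic2 ::
  "(complex \<times> complex) set \<Rightarrow> (complex \<times> complex) set \<Rightarrow> (complex \<times> complex \<Rightarrow> complex \<times> complex) \<Rightarrow> bool" where
  "biholomorphic2 W W' \<Phi> \<longleftrightarrow> bij_betw \<Phi> W W' \<and>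
     holomorphic2_on W (fst \<circ> \<Phi>) \<and> holomorphic2_on W (snd \<circ> \<Phi>) \<and>
     holomorphic2_on W' (fst \<circ> inv_into W \<Phi>) \<and> holomorphic2_on W' (snd \<circ> inv_into W \<Phi>)"

definition sphere_holomorphic2_on ::
  "(riemann_sphere \<times> riemann_sphere) set \<Rightarrow> (riemann_sphere \<times> riemann_sphere \<Rightarrow> complex) \<Rightarrow> bool" where
  "sphere_holomorphic2_on U f \<longleftrightarrow> open U \<and>
     (\<forall>\<phi>\<in>sphere_params. \<forall>\<psi>\<in>sphere_params.
        holomorphic2_on (map_prod \<phi> \<psi> -` U) (f \<circ> map_prod \<phi> \<psi>))"

definition analytic_subvariety :: "(riemann_sphere \<times> riemann_sphere) set \<Rightarrow> bool" where
  "analytic_subvariety V \<longleftrightarrow>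
     (\<forall>p. \<exists>U \<F>. open U \<and> p \<in> U \<and> finite \<F> \<and> (\<forall>f\<in>\<F>. sphere_holomorphic2_on U f) \<and>
        V \<inter> U = {q \<in> U. \<forall>f\<in>\<F>. f q = 0})"

definition irreducible_subvariety :: "(riemann_sphere \<times> riemann_sphere) set \<Rightarrow> bool" where
  "irreducible_subvariety V \<longleftrightarrow> analytic_subvariety V \<and> V \<noteq> {} \<and>
     (\<forall>A B. analytic_subvariety A \<and> analytic_subvariety B \<and> V = A \<union> B \<longrightarrow> V = A \<or> V = B)"

definition coord_plane :: "nat \<Rightarrow> (complex \<times> complex) set" where
  "coord_plane k = {(x, y). (k < 1 \<longrightarrow> x = 0) \<and> (k < 2 \<longrightarrow> y = 0)}"

text \<open>\<open>p\<close> is a regular point of \<open>V\<close> of dimension \<open>k\<close>: near \<open>p\<close> there are holomorphic coordinates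
  which turn \<open>V\<close> into the \<open>k\<close>-dimensional coordinate plane.\<close>

definition regular_point ::
  "nat \<Rightarrow> (riemann_sphere \<times> riemann_sphere) set \<Rightarrow> riemann_sphere \<times> riemann_sphere \<Rightarrow> bool" where
  "regular_point k V p \<longleftrightarrow> p \<in> V \<and>
     (\<exists>\<phi>\<in>sphere_params. \<exists>\<psi>\<in>sphere_params. \<exists>W W' \<Phi>.
        biholomorphic2 W W' \<Phi> \<and> p \<in> map_prod \<phi> \<psi> ` W \<and>
        (\<forall>q\<in>W. map_prod \<phi> \<psi> q \<in> V \<longleftrightarrow> \<Phi> q \<in> coord_plane k))"

definition analytic_dim :: "(riemann_sphere \<times> riemann_sphere) set \<Rightarrow> nat" where
  "analytic_dim V = Max {k. k \<le> 2 \<and> (\<exists>p. regular_point k V p)}"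


section \<open>Holomorphic correspondences\<close>

text \<open>The formal sum of the \<open>comp_mult \<alpha>\<close>-fold multiples of \<open>component \<alpha>\<close>, for \<open>\<alpha> = 1, \<dots>, ncomps\<close>;
  values of the two functions at other indices are irrelevant.\<close>

record correspondence =
  ncomps :: nat
  comp_mult :: "nat \<Rightarrow> nat"
  component :: "nat \<Rightarrow> (riemann_sphere \<times> riemann_sphere) set"

definition holomorphic_correspondence :: "correspondence \<Rightarrow> bool" where
  "holomorphic_correspondence \<Gamma> \<longleftrightarrow>
     1 \<le> ncomps \<Gamma> \<and> inj_on (component \<Gamma>) {1..ncomps \<Gamma>} \<and>
     (\<forall>\<alpha>\<in>{1..ncomps \<Gamma>}.
        1 \<le> comp_mult \<Gamma> \<alpha> \<and>
        irreducible_subvariety (component \<Gamma> \<alpha>) \<and> analytic_dim (component \<Gamma> \<alpha>) = 1 \<and>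
        fst ` component \<Gamma> \<alpha> = UNIV \<and> snd ` component \<Gamma> \<alpha> = UNIV \<and>
        (\<forall>\<^sub>F z in cofinite. finite (fst ` (snd -` {z} \<inter> component \<Gamma> \<alpha>)) \<and>
                           finite (snd ` (fst -` {z} \<inter> component \<Gamma> \<alpha>))))"

definition support :: "correspondence \<Rightarrow> (riemann_sphere \<times> riemann_sphere) set" where
  "support \<Gamma> = (\<Union>\<alpha>\<in>{1..ncomps \<Gamma>}. component \<Gamma> \<alpha>)"

definition corr_map :: "correspondence \<Rightarrow> riemann_sphere \<Rightarrow> riemann_sphere set" where
  "corr_map \<Gamma> z = {w. (z, w) \<in> support \<Gamma>}"

definition corr_preimages :: "correspondence \<Rightarrow> riemann_sphere \<Rightarrow> riemann_sphere set" where
  "corr_preimages \<Gamma> z = {w. (w, z) \<in> support \<Gamma>}"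

text \<open>The values of the \<open>p\<close>-fold composition of the correspondence, as sets.\<close>

fun corr_iter :: "correspondence \<Rightarrow> nat \<Rightarrow> riemann_sphere \<Rightarrow> riemann_sphere set" where
  "corr_iter \<Gamma> 0 z = {z}"
| "corr_iter \<Gamma> (Suc p) z = (\<Union>w\<in>corr_iter \<Gamma> p z. corr_map \<Gamma> w)"

text \<open>Multiplicity of \<open>w\<close> as a preimage of \<open>z\<close> under a curve \<open>A\<close>: the local degree at \<open>(w, z)\<close> of
  the second projection restricted to \<open>A\<close>, i.e. the number of distinct preimages of any
  \<open>z' \<noteq> z\<close> close to \<open>z\<close> which lie in a fixed small neighbourhood of \<open>w\<close>.\<close>

definition local_mult ::
  "(riemann_sphere \<times> riemann_sphere) set \<Rightarrow> riemann_sphere \<Rightarrow> riemann_sphere \<Rightarrow> nat" where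
  "local_mult A w z =
     (THE k. \<exists>W0. open W0 \<and> w \<in> W0 \<and>
        (\<forall>W. open W \<and> w \<in> W \<and> W \<subseteq> W0 \<longrightarrow>
           (\<forall>\<^sub>F z' in at z. card {w' \<in> W. (w', z') \<in> A} = k)))"

definition preimage_mult :: "correspondence \<Rightarrow> riemann_sphere \<Rightarrow> riemann_sphere \<Rightarrow> nat" where
  "preimage_mult \<Gamma> w z =
     (\<Sum>\<alpha> | \<alpha> \<in> {1..ncomps \<Gamma>} \<and> (w, z) \<in> component \<Gamma> \<alpha>.
        comp_mult \<Gamma> \<alpha> * local_mult (component \<Gamma> \<alpha>) w z)"

definition top_degree :: "correspondence \<Rightarrow> nat" where
  "top_degree \<Gamma> =
     (THE d. \<forall>\<^sub>F z in cofinite. (\<Sum>w\<in>corr_preimages \<Gamma> z. preimage_mult \<Gamma> w z) = d)"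


section \<open>Measures on the sphere\<close>

definition sphere_prob_measures :: "riemann_sphere measure set" where
  "sphere_prob_measures = {\<mu>. sets \<mu> = sets borel \<and> prob_space \<mu>}"

definition pullback_invariant :: "correspondence \<Rightarrow> riemann_sphere measure \<Rightarrow> bool" where
  "pullback_invariant \<Gamma> \<mu> \<longleftrightarrow>
     (\<forall>f :: riemann_sphere \<Rightarrow> real. continuous_on UNIV f \<longrightarrow>
        (\<integral>z. f z \<partial>\<mu>) =
        1 / real (top_degree \<Gamma>) *
          (\<integral>z. (\<Sum>w\<in>corr_preimages \<Gamma> z. real (preimage_mult \<Gamma> w z) * f w) \<partial>\<mu>))"

text \<open>The mean of \<open>u\<close> over a circle, for \<open>u\<close> with values in the extended reals: the integral of
  the positive part minus the integral of the negative part.  For upper semicontinuous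
  \<open>u < \<infinity>\<close> the former is finite, so the difference is meaningful.\<close>

definition circle_mean :: "(complex \<Rightarrow> ereal) \<Rightarrow> complex \<Rightarrow> real \<Rightarrow> ereal" where
  "circle_mean u z r =
     (let M = uniform_measure lborel {0..2 * pi};
          v = (\<lambda>t. u (z + of_real r * cis t))
      in enn2ereal (\<integral>\<^sup>+ t. e2ennreal (v t) \<partial>M) - enn2ereal (\<integral>\<^sup>+ t. e2ennreal (- v t) \<partial>M))"

text \<open>The constant \<open>-\<infinity>\<close> is not excluded here, but in the definition of polar sets.\<close>

definition subharmonic_on :: "complex set \<Rightarrow> (complex \<Rightarrow> ereal) \<Rightarrow> bool" where
  "subharmonic_on V u \<longleftrightarrow> open V \<and> (\<forall>z\<in>V. u z < \<infinity>) \<and>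
     (\<forall>c. open {z \<in> V. u z < c}) \<and>
     (\<forall>z r. r > 0 \<and> cball z r \<subseteq> V \<longrightarrow> u z \<le> circle_mean u z r)"

definition polar_set :: "riemann_sphere set \<Rightarrow> bool" where
  "polar_set P \<longleftrightarrow>
     (\<forall>p\<in>P. \<exists>\<phi>\<in>sphere_params. \<exists>V u. open V \<and> connected V \<and> p \<in> \<phi> ` V \<and>
        subharmonic_on V u \<and> (\<exists>z\<in>V. u z \<noteq> -\<infinity>) \<and>
        (\<forall>z\<in>V. \<phi> z \<in> P \<longrightarrow> u z = -\<infinity>))"


section \<open>The orbit space and its shift\<close>

type_synonym orbit = "(int \<Rightarrow> riemann_sphere) \<times> (int \<Rightarrow> nat)"

definition orbit_space :: "correspondence \<Rightarrow> orbit set" where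
  "orbit_space \<Gamma> = {(z, \<gamma>). \<forall>n. \<gamma> n \<in> {1..ncomps \<Gamma>} \<and> (z (n - 1), z n) \<in> component \<Gamma> (\<gamma> n)}"

definition kronecker :: "nat \<Rightarrow> nat \<Rightarrow> real" where
  "kronecker i j = (if i = j then 1 else 0)"

fun orbit_dist :: "orbit \<Rightarrow> orbit \<Rightarrow> real" where
  "orbit_dist (z, \<gamma>) (w, \<gamma>') =
     max (SUP n. dist (z n) (w n) / 2 ^ nat \<bar>n\<bar>)
         (SUP n\<in>{1::nat..}.
            max (1 - kronecker (\<gamma> (int n)) (\<gamma>' (int n)))
                (1 - kronecker (\<gamma> (1 - int n)) (\<gamma>' (1 - int n))) / 2 ^ n)"

lemma SUP_pseudometric:
  fixes d :: "'i \<Rightarrow> 'a \<Rightarrow> 'a \<Rightarrow> real"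
  assumes "I \<noteq> {}" and b: "\<And>i x y. i \<in> I \<Longrightarrow> 0 \<le> d i x y \<and> d i x y \<le> B"
  shows "i \<in> I \<Longrightarrow> d i x y \<le> (SUP i\<in>I. d i x y)"
    and "(\<And>i. i \<in> I \<Longrightarrow> d i x z \<le> d i x y + d i y z) \<Longrightarrow>
           (SUP i\<in>I. d i x z) \<le> (SUP i\<in>I. d i x y) + (SUP i\<in>I. d i y z)"
proof -
  have bdd: "bdd_above ((\<lambda>i. d i x y) ` I)" for x y
    using b by (auto intro!: bdd_aboveI)
  show up: "d i x y \<le> (SUP i\<in>I. d i x y)" if "i \<in> I" for i x y
    using that bdd by (rule cSUP_upper)
  assume tri: "\<And>i. i \<in> I \<Longrightarrow> d i x z \<le> d i x y + d i y z"
  have "d i x z \<le> (SUP i\<in>I. d i x y) + (SUP i\<in>I. d i y z)" if "i \<in> I" for i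
    using tri[OF that] up[OF that, of x y] up[OF that, of y z] by linarith
  then show "(SUP i\<in>I. d i x z) \<le> (SUP i\<in>I. d i x y) + (SUP i\<in>I. d i y z)"
    by (rule cSUP_least[OF assms(1)])
qed

lemma Metric_space_orbit: "Metric_space (orbit_space \<Gamma>) orbit_dist"
proof -
  define d1 :: "int \<Rightarrow> orbit \<Rightarrow> orbit \<Rightarrow> real" where
    "d1 = (\<lambda>n x y. dist (fst x n) (fst y n) / 2 ^ nat \<bar>n\<bar>)"
  define d2 :: "nat \<Rightarrow> orbit \<Rightarrow> orbit \<Rightarrow> real" where
    "d2 = (\<lambda>n x y. max (1 - kronecker (snd x (int n)) (snd y (int n)))
                (1 - kronecker (snd x (1 - int n)) (snd y (1 - int n))) / 2 ^ n)"
  have od: "orbit_dist x y = max (SUP n. d1 n x y) (SUP n\<in>{1..}. d2 n x y)" for x y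
    by (cases x; cases y) (simp add: d1_def d2_def)
  have pw: "a / 2 ^ n \<le> a" if "a \<ge> 0" for a :: real and n :: nat
    using that by (simp add: divide_simps mult_le_cancel_left1)
  have b1: "0 \<le> d1 n x y \<and> d1 n x y \<le> pi" for n x y
    using pw[of "dist (fst x n) (fst y n)" "nat \<bar>n\<bar>"]
      dist_riemann_sphere_le_pi[of "fst x n" "fst y n"] by (auto simp: d1_def)
  have b2: "0 \<le> d2 n x y \<and> d2 n x y \<le> 1" for n x y
    using pw[of 1 n] by (auto simp: d2_def kronecker_def)
  have t1: "d1 n x z \<le> d1 n x y + d1 n y z" for n x y z
    unfolding d1_def add_divide_distrib[symmetric]
    by (intro divide_right_mono dist_triangle) auto
  have t2: "d2 n x z \<le> d2 n x y + d2 n y z" for n x y z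
    unfolding d2_def add_divide_distrib[symmetric]
    by (intro divide_right_mono) (auto simp: kronecker_def)
  note S1 = SUP_pseudometric[where I = UNIV and d = d1 and B = pi, OF _ b1, simplified]
  note S2 = SUP_pseudometric[where I = "{1..}" and d = d2 and B = 1, OF _ b2, simplified]
  show ?thesis
  proof
    fix x y
    show "0 \<le> orbit_dist x y"
      using S1(1)[of 0 x y] b1[of 0 x y] unfolding od by linarith
    show "orbit_dist x y = orbit_dist y x"
      by (simp add: od d1_def d2_def dist_commute kronecker_def eq_commute)
    show "orbit_dist x y = 0 \<longleftrightarrow> x = y"
    proof
      assume 0: "orbit_dist x y = 0"
      have z1: "d1 n x y = 0" for n
        using 0 S1(1)[of n x y] b1[of n x y] unfolding od by linarith
      have z2: "d2 n x y = 0" if "n \<ge> 1" for n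
      proof -
        have "d2 n x y \<le> (SUP n\<in>{1..}. d2 n x y)"
          using S2(1)[of n x y] that by simp
        then show ?thesis using 0 b2[of n x y] unfolding od by linarith
      qed
      have "fst x n = fst y n" for n using z1[of n] by (simp add: d1_def)
      moreover have "snd x n = snd y n" for n
      proof -
        have e: "snd x (int k) = snd y (int k) \<and> snd x (1 - int k) = snd y (1 - int k)"
          if "k \<ge> 1" for k
          using z2[OF that] by (auto simp: d2_def kronecker_def split: if_splits)
        show ?thesis
          using e[of "nat n"] e[of "nat (1 - n)"] by (cases "n \<ge> 1") auto
      qed
      ultimately show "x = y" by (intro prod_eqI ext)
    next
      assume "x = y"
      then show "orbit_dist x y = 0" by (simp add: od d1_def d2_def kronecker_def)
    qed
  next
    fix x y z
    show "orbit_dist x z \<le> orbit_dist x y + orbit_dist y z"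
    proof -
      have "(SUP n. d1 n x z) \<le> (SUP n. d1 n x y) + (SUP n. d1 n y z)"
        by (rule S1(2)) (rule t1)
      moreover have "(SUP n\<in>{1..}. d2 n x z) \<le> (SUP n\<in>{1..}. d2 n x y) + (SUP n\<in>{1..}. d2 n y z)"
        using S2(2)[OF t2, of x z y] by simp
      ultimately show ?thesis unfolding od by linarith
    qed
  qed
qed

definition orbit_borel :: "correspondence \<Rightarrow> orbit measure" where
  "orbit_borel \<Gamma> = sigma (orbit_space \<Gamma>)
     {U. openin (Metric_space.mtopology (orbit_space \<Gamma>) orbit_dist) U}"

definition orbit_shift :: "orbit \<Rightarrow> orbit" where
  "orbit_shift = (\<lambda>(z, \<gamma>). (\<lambda>n. z (n + 1), \<lambda>n. \<gamma> (n + 1)))"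

definition orbit_proj0 :: "orbit \<Rightarrow> riemann_sphere" where
  "orbit_proj0 = (\<lambda>(z, \<gamma>). z 0)"

definition shift_invariant_measures :: "correspondence \<Rightarrow> orbit measure set" where
  "shift_invariant_measures \<Gamma> =
     {M. sets M = sets (orbit_borel \<Gamma>) \<and> prob_space M \<and> distr M M orbit_shift = M}"

definition shift_ergodic :: "orbit measure \<Rightarrow> bool" where
  "shift_ergodic M \<longleftrightarrow>
     (\<forall>A\<in>sets M. orbit_shift -` A \<inter> space M = A \<longrightarrow> measure M A = 0 \<or> measure M A = 1)"

definition ergodic_projections :: "correspondence \<Rightarrow> riemann_sphere measure set" where
  "ergodic_projections \<Gamma> =
     {\<mu> \<in> sphere_prob_measures.
        \<exists>M\<in>shift_invariant_measures \<Gamma>. shift_ergodic M \<and> \<mu> = distr M borel orbit_proj0}"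


section \<open>First return time\<close>

text \<open>\<open>\<infinity>\<close> if no iterate of \<open>z\<close> meets \<open>E\<close>.\<close>

definition first_return_time :: "correspondence \<Rightarrow> riemann_sphere set \<Rightarrow> riemann_sphere \<Rightarrow> enat" where
  "first_return_time \<Gamma> E z = Inf {enat p |p. 1 \<le> p \<and> corr_iter \<Gamma> p z \<inter> E \<noteq> {}}"

end

theory Submission
  imports Defs
begin

text \<open>Let \<open>M\<close> be an invariant measure on the orbit space that projects to \<open>\<mu>\<close>, and let \<open>A\<close> be
  the set of orbits with \<open>z\<^sub>0 \<in> E\<close>. Along an orbit \<open>z\<^sub>p\<close> lies in the \<open>p\<close>-th image of \<open>z\<^sub>0\<close>, so the
  return time of \<open>z\<^sub>0\<close> to \<open>E\<close> is at most the return time of the orbit to \<open>A\<close> under the shift, whose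
  integral over \<open>A\<close> is at most 1 by the argument of Kac's lemma: the sets
  \<open>{x. T x \<notin> A, \<dots>, T\<^sup>p x \<notin> A}\<close> have measures that telescope.\<close>

section \<open>Return times of measure preserving maps\<close>

text \<open>The function \<open>g\<close> need not be measurable: \<open>nn_integral\<close> is then a lower integral.\<close>

lemma nn_integral_leI:
  assumes "\<And>s. s \<in> borel_measurable M \<Longrightarrow> s \<le> g \<Longrightarrow> integral\<^sup>N M s \<le> C"
  shows "integral\<^sup>N M g \<le> C"
  unfolding nn_integral_def
proof (rule SUP_least, clarify)
  fix s assume s: "simple_function M s" "s \<le> g"
  then have "integral\<^sup>N M s \<le> C"
    by (intro assms borel_measurable_simple_function)
  then show "integral\<^sup>S M s \<le> C"
    using s by (simp add: nn_integral_eq_simple_integral)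
qed

text \<open>At a point of \<open>A\<close> the series counts the p >= 0 such that no return happens
  at the times 1, ..., p, so it equals the return time to \<open>A\<close> (infinite without a
  return); outside \<open>A\<close> it is 0.\<close>

lemma nn_integral_return_time_le:
  assumes M: "prob_space M" and T: "T \<in> measurable M M" and inv: "distr M M T = M"
    and A: "A \<in> sets M"
  shows "(\<integral>\<^sup>+x. (\<Sum>p. indicator {x \<in> A. \<forall>k\<in>{1..p}. (T ^^ k) x \<notin> A} x) \<partial>M) \<le> 1"
proof -
  interpret prob_space M by (fact M)
  define D where "D p = {x \<in> space M. \<forall>k\<in>{1..p}. (T ^^ k) x \<notin> A}" for p
  define B where "B p = {x \<in> A. \<forall>k\<in>{1..p}. (T ^^ k) x \<notin> A}" for p
  have Asp: "A \<subseteq> space M" using A by (rule sets.sets_into_space)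
  have Tk: "T ^^ k \<in> measurable M M" for k
    using T by (induction k) auto
  have D: "D p \<in> sets M" for p
  proof -
    have "D p = space M - (\<Union>k\<in>{1..p}. (T ^^ k) -` A \<inter> space M)"
      by (auto simp: D_def)
    also have "\<dots> \<in> sets M"
      by (intro sets.Diff sets.top sets.finite_UN finite_atLeastAtMost measurable_sets[OF Tk A])
    finally show ?thesis .
  qed
  have BD: "B p = A \<inter> D p" for p using Asp by (auto simp: B_def D_def)
  then have B: "B p \<in> sets M" for p using A D by auto
  \<comment> \<open>The condition at k = 1 says that \<open>T x\<close> avoids \<open>A\<close>;
    those at k = 2, ..., p + 1 are the conditions of \<open>D p\<close> on
    \<open>T x\<close>.\<close>
  have step: "D (Suc p) = T -` (D p - A) \<inter> space M" for p
  proof -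
    have "(\<forall>k\<in>{1..Suc p}. (T ^^ k) x \<notin> A) \<longleftrightarrow> T x \<notin> A \<and> (\<forall>k\<in>{1..p}. (T ^^ k) (T x) \<notin> A)" for x
    proof -
      have "{1..Suc p} = insert 1 (Suc ` {1..p})" by (auto simp: image_Suc_atLeastAtMost)
      then show ?thesis by (simp add: funpow_swap1 del: image_Suc_atLeastAtMost)
    qed
    then show ?thesis using measurable_space[OF T] by (auto simp: D_def)
  qed
  \<comment> \<open>By invariance \<open>D (Suc p)\<close> has the measure of
    \<open>D p - A\<close>, and \<open>B p\<close> is what is removed from
    \<open>D p\<close>.\<close>
  have tel: "prob (B p) = prob (D p) - prob (D (Suc p))" for p
  proof -
    have "prob (D (Suc p)) = measure (distr M M T) (D p - A)"
      using D A by (subst measure_distr[OF T]) (auto simp: step)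
    also have "\<dots> = prob (D p - A)" by (simp add: inv)
    finally have "prob (D (Suc p)) = prob (D p - A)" .
    moreover have "prob (D p) = prob (B p) + prob (D p - A)"
      using D A unfolding BD
      by (subst finite_measure_Union[symmetric]) (auto intro!: arg_cong[where f=prob])
    ultimately show ?thesis by simp
  qed
  have "(\<integral>\<^sup>+x. (\<Sum>p. indicator (B p) x) \<partial>M) = (\<Sum>p. emeasure M (B p))"
    using B by (subst nn_integral_suminf) auto
  also have "\<dots> \<le> 1"
  proof (rule suminf_le_const)
    fix n
    have "(\<Sum>p<n. emeasure M (B p)) = ennreal (\<Sum>p<n. prob (B p))"
      by (simp add: emeasure_eq_measure sum_ennreal)
    \<comment> \<open>Discarding \<open>prob (D n)\<close> is where equality may be lost.\<close>
    moreover have "(\<Sum>p<n. prob (B p)) = prob (D 0) - prob (D n)"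
      unfolding tel by (rule sum_lessThan_telescope')
    then have "(\<Sum>p<n. prob (B p)) \<le> 1"
      using prob_le_1[of "D 0"] measure_nonneg[of M "D n"] by linarith
    ultimately show "(\<Sum>p<n. emeasure M (B p)) \<le> 1" by simp
  qed simp
  finally show ?thesis by (simp add: B_def)
qed

text \<open>Each finite k \<le> n is bounded by the first k terms. This turns a bound on a possibly
  infinite return time into a termwise check of indicators.\<close>

lemma ennreal_of_enat_le_suminf:
  fixes f :: "nat \<Rightarrow> ennreal"
  assumes "\<And>p. enat p < n \<Longrightarrow> 1 \<le> f p"
  shows "ennreal_of_enat n \<le> (\<Sum>p. f p)"
proof -
  have le: "of_nat k \<le> (\<Sum>p. f p)" if "enat k \<le> n" for k
  proof -
    have "of_nat k = (\<Sum>p<k. 1::ennreal)" by simp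
    also have "\<dots> \<le> (\<Sum>p<k. f p)"
      using that by (intro sum_mono assms) (auto intro: less_le_trans[of _ "enat k"])
    also have "\<dots> \<le> (\<Sum>p. f p)" by (rule sum_le_suminf) auto
    finally show ?thesis .
  qed
  show ?thesis
  proof (cases n)
    case infinity
    \<comment> \<open>For infinite n, \<open>le\<close> applies to every natural number, so the sum
      has no finite value.\<close>
    have "(\<Sum>p. f p) = \<top>"
    proof (rule ccontr)
      assume "(\<Sum>p. f p) \<noteq> \<top>"
      then obtain k where "(\<Sum>p. f p) < of_nat k"
        using ennreal_Ex_less_of_nat[of "\<Sum>p. f p"] by (auto simp: less_top)
      then show False using le[of k] infinity by simp
    qed
    then show ?thesis by simp
  qed (use le in auto)
qed

section \<open>Measurability in the orbit space\<close>

text \<open>A real \<open>SUP\<close> dominates its terms only if the family is bounded; here pi,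
  the diameter bound of the sphere, serves.\<close>

lemma dist_le_orbit_dist: "dist (fst x n) (fst y n) / 2 ^ nat \<bar>n\<bar> \<le> orbit_dist x y"
proof -
  have "a / 2 ^ m \<le> pi" if "a \<le> pi" for a :: real and m :: nat
  proof -
    have "a \<le> pi * 2 ^ m"
      using that mult_left_mono[OF one_le_power[of "2::real" m] pi_ge_zero] by linarith
    then show ?thesis by (simp add: divide_le_eq)
  qed
  then have "bdd_above (range (\<lambda>n. dist (fst x n) (fst y n) / 2 ^ nat \<bar>n\<bar>))"
    using dist_riemann_sphere_le_pi by (intro bdd_aboveI[where M = pi]) auto
  then show ?thesis
    by (cases x; cases y) (auto intro!: max.coboundedI1 cSUP_upper)
qed

lemma kronecker_le_orbit_dist:
  assumes "1 \<le> n"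
  shows "max (1 - kronecker (snd x (int n)) (snd y (int n)))
             (1 - kronecker (snd x (1 - int n)) (snd y (1 - int n))) / 2 ^ n \<le> orbit_dist x y"
proof -
  have "bdd_above ((\<lambda>n. max (1 - kronecker (snd x (int n)) (snd y (int n)))
             (1 - kronecker (snd x (1 - int n)) (snd y (1 - int n))) / 2 ^ n) ` {1::nat..})"
    by (intro bdd_aboveI[where M = 1]) (auto simp: kronecker_def divide_le_eq_1)
  then show ?thesis using assms
    by (cases x; cases y) (auto intro!: max.coboundedI2 cSUP_upper)
qed

text \<open>Moving an index by one changes its weight by a factor of at most 2, both for the points
  and for the symbols. This gives continuity of the shift.\<close>

lemma orbit_dist_shift_le: "orbit_dist (orbit_shift x) (orbit_shift y) \<le> 2 * orbit_dist x y"
proof -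
  obtain z \<gamma> w \<delta> where xy: "x = (z, \<gamma>)" "y = (w, \<delta>)" by (cases x; cases y) auto
  let ?d = "orbit_dist (z, \<gamma>) (w, \<delta>)"
  have 1: "dist (z (n + 1)) (w (n + 1)) / 2 ^ nat \<bar>n\<bar> \<le> 2 * ?d" for n
  proof -
    have "(2::real) ^ nat \<bar>n + 1\<bar> \<le> 2 ^ (Suc (nat \<bar>n\<bar>))"
      by (rule power_increasing) auto
    then have "dist (z (n + 1)) (w (n + 1)) / (2 * 2 ^ nat \<bar>n\<bar>)
                 \<le> dist (z (n + 1)) (w (n + 1)) / 2 ^ nat \<bar>n + 1\<bar>"
      by (intro divide_left_mono) auto
    also have "\<dots> \<le> ?d" using dist_le_orbit_dist[of "(z, \<gamma>)" "n + 1" "(w, \<delta>)"] by simp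
    finally show ?thesis by simp
  qed
  define u where "u m = 1 - kronecker (\<gamma> m) (\<delta> m)" for m
  have u0: "0 \<le> u m" for m by (simp add: u_def kronecker_def)
  have k: "u i / 2 ^ m \<le> ?d" if "1 \<le> m" "i \<in> {int m, 1 - int m}" for i m
  proof -
    have "u i / 2 ^ m \<le> max (u (int m)) (u (1 - int m)) / 2 ^ m"
      using that(2) by (intro divide_right_mono) auto
    also have "\<dots> \<le> ?d"
      using kronecker_le_orbit_dist[OF that(1), of "(z, \<gamma>)" "(w, \<delta>)"] by (simp add: u_def)
    finally show ?thesis .
  qed
  have 2: "max (u (int n + 1)) (u (1 - int n + 1)) / 2 ^ n \<le> 2 * ?d" if n: "1 \<le> n" for n
  proof -
    have a: "u (int n + 1) / 2 ^ n \<le> 2 * ?d"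
      using k[of "Suc n" "int n + 1"] by (simp add: divide_simps mult.commute)
    have b: "u (1 - int n + 1) / 2 ^ n \<le> 2 * ?d"
    \<comment> \<open>For n = 1 the shifted index is 1, which belongs to the pair {1, 0} of the same
      weight; for n = m + 1 with m \<ge> 1 it is 1 - m, in the pair of the larger weight
      \<open>1 / 2 ^ m\<close>.\<close>
    proof (cases "n = 1")
      case True
      then show ?thesis using k[of 1 1] u0[of 1] by simp
    next
      case False
      then obtain m where m: "n = Suc m" "1 \<le> m" using n by (cases n) auto
      have "u (1 - int m) / 2 ^ m \<le> ?d" using k[OF m(2)] by simp
      moreover have "u (1 - int m) / 2 ^ n \<le> u (1 - int m) / 2 ^ m"
        using u0[of "1 - int m"] by (intro divide_left_mono) (auto simp: m)
      moreover have "0 \<le> u (1 - int m) / 2 ^ m" using u0 by simp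
      ultimately have "u (1 - int m) / 2 ^ n \<le> 2 * ?d" by linarith
      then show ?thesis using m(1) by simp
    qed
    show ?thesis using a b by (metis max_def)
  qed
  have "(SUP n. dist (z (n + 1)) (w (n + 1)) / 2 ^ nat \<bar>n\<bar>) \<le> 2 * ?d"
    by (rule cSUP_least[OF UNIV_not_empty 1])
  moreover have "(SUP n\<in>{1::nat..}. max (u (int n + 1)) (u (1 - int n + 1)) / 2 ^ n) \<le> 2 * ?d"
    by (rule cSUP_least) (use 2 in \<open>simp_all only: atLeast_iff, blast\<close>)
  ultimately show ?thesis by (simp add: xy orbit_shift_def u_def)
qed

lemma orbit_shift_in_orbit_space: "x \<in> orbit_space \<Gamma> \<Longrightarrow> orbit_shift x \<in> orbit_space \<Gamma>"
proof -
  assume "x \<in> orbit_space \<Gamma>"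
  then obtain z \<gamma> where x: "x = (z, \<gamma>)"
    and h: "\<And>n. \<gamma> n \<in> {1..ncomps \<Gamma>} \<and> (z (n - 1), z n) \<in> component \<Gamma> (\<gamma> n)"
    by (auto simp: orbit_space_def)
  have "\<gamma> (n + 1) \<in> {1..ncomps \<Gamma>} \<and> (z (n - 1 + 1), z (n + 1)) \<in> component \<Gamma> (\<gamma> (n + 1))" for n
    using h[of "n + 1"] by simp
  then show ?thesis by (auto simp: x orbit_space_def orbit_shift_def)
qed

text \<open>The second part lets open sets be verified by balls of \<open>orbit_dist\<close>,
  without further recourse to the abstract topology.\<close>

lemma
  shows space_orbit_borel: "space (orbit_borel \<Gamma>) = orbit_space \<Gamma>"
    and open_in_sets_orbit_borel:
      "U \<subseteq> orbit_space \<Gamma> \<Longrightarrow>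
        (\<And>x. x \<in> U \<Longrightarrow> \<exists>r>0. \<forall>y\<in>orbit_space \<Gamma>. orbit_dist x y < r \<longrightarrow> y \<in> U) \<Longrightarrow>
        U \<in> sets (orbit_borel \<Gamma>)"
proof -
  interpret Metric_space "orbit_space \<Gamma>" orbit_dist by (rule Metric_space_orbit)
  have sub: "{U. openin mtopology U} \<subseteq> Pow (orbit_space \<Gamma>)"
    using openin_subset by fastforce
  show "space (orbit_borel \<Gamma>) = orbit_space \<Gamma>"
    unfolding orbit_borel_def by (rule space_measure_of[OF sub])
  assume U: "U \<subseteq> orbit_space \<Gamma>"
    and loc: "\<And>x. x \<in> U \<Longrightarrow> \<exists>r>0. \<forall>y\<in>orbit_space \<Gamma>. orbit_dist x y < r \<longrightarrow> y \<in> U"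
  have "\<exists>r>0. mball x r \<subseteq> U" if "x \<in> U" for x
    using loc[OF that] by (auto simp: in_mball subset_eq)
  then have "openin mtopology U" using U by (simp add: openin_mtopology)
  then show "U \<in> sets (orbit_borel \<Gamma>)"
    unfolding orbit_borel_def by (auto simp: sets_measure_of[OF sub])
qed

lemma measurable_orbit_proj0: "orbit_proj0 \<in> borel_measurable (orbit_borel \<Gamma>)"
proof (rule borel_measurableI)
  fix S :: "riemann_sphere set" assume S: "open S"
  show "orbit_proj0 -` S \<inter> space (orbit_borel \<Gamma>) \<in> sets (orbit_borel \<Gamma>)"
    unfolding space_orbit_borel
  proof (rule open_in_sets_orbit_borel)
    fix x assume "x \<in> orbit_proj0 -` S \<inter> orbit_space \<Gamma>"
    then obtain r where r: "r > 0" "\<And>v. dist v (orbit_proj0 x) < r \<Longrightarrow> v \<in> S"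
      using S unfolding open_dist by blast
    \<comment> \<open>The weight at index 0 is 1, so the projection is 1-Lipschitz.\<close>
    have "dist (orbit_proj0 y) (orbit_proj0 x) \<le> orbit_dist x y" for y
      using dist_le_orbit_dist[of x 0 y]
      by (simp add: orbit_proj0_def case_prod_beta dist_commute)
    then show "\<exists>r>0. \<forall>y\<in>orbit_space \<Gamma>. orbit_dist x y < r \<longrightarrow> y \<in> orbit_proj0 -` S \<inter> orbit_space \<Gamma>"
      using r by (intro exI[of _ r]) (auto intro: le_less_trans)
  qed auto
qed

lemma measurable_orbit_shift: "orbit_shift \<in> measurable (orbit_borel \<Gamma>) (orbit_borel \<Gamma>)"
proof -
  interpret Metric_space "orbit_space \<Gamma>" orbit_dist by (rule Metric_space_orbit)
  show ?thesis
    unfolding orbit_borel_def[of \<Gamma>]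
  proof (rule measurable_sigma_sets[OF sets_measure_of])
    show sub: "{U. openin mtopology U} \<subseteq> Pow (orbit_space \<Gamma>)"
      using openin_subset by fastforce
    then show "{U. openin mtopology U} \<subseteq> Pow (orbit_space \<Gamma>)" .
    show "orbit_shift \<in> space (sigma (orbit_space \<Gamma>) {U. openin mtopology U}) \<rightarrow> orbit_space \<Gamma>"
      using orbit_shift_in_orbit_space by (auto simp: space_measure_of[OF sub])
    fix S assume "S \<in> {U. openin mtopology U}"
    then have S: "\<And>x. x \<in> S \<Longrightarrow> \<exists>r>0. mball x r \<subseteq> S"
      unfolding mem_Collect_eq openin_mtopology by blast
    have "orbit_shift -` S \<inter> orbit_space \<Gamma> \<in> sets (orbit_borel \<Gamma>)"
    proof (rule open_in_sets_orbit_borel)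
      fix x assume x: "x \<in> orbit_shift -` S \<inter> orbit_space \<Gamma>"
      then obtain r where r: "r > 0" "mball (orbit_shift x) r \<subseteq> S" using S by blast
      \<comment> \<open>Half the radius compensates for the Lipschitz constant 2.\<close>
      have "orbit_shift y \<in> S" if "y \<in> orbit_space \<Gamma>" "orbit_dist x y < r / 2" for y
        using r(2) that x orbit_dist_shift_le[of x y]
        by (auto simp: in_mball subset_eq orbit_shift_in_orbit_space)
      then show "\<exists>r>0. \<forall>y\<in>orbit_space \<Gamma>. orbit_dist x y < r \<longrightarrow> y \<in> orbit_shift -` S \<inter> orbit_space \<Gamma>"
        using r(1) by (intro exI[of _ "r / 2"]) auto
    qed auto
    then show "orbit_shift -` S \<inter> space (sigma (orbit_space \<Gamma>) {U. openin mtopology U})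
                 \<in> sets (sigma (orbit_space \<Gamma>) {U. openin mtopology U})"
      by (simp add: orbit_borel_def space_measure_of[OF sub])
  qed
qed

section \<open>Orbits and the first return time\<close>

lemma orbit_proj0_shift_iter: "orbit_proj0 ((orbit_shift ^^ k) (z, \<gamma>)) = z (int k)"
proof -
  have "(orbit_shift ^^ k) (z, \<gamma>) = (\<lambda>n. z (n + int k), \<lambda>n. \<gamma> (n + int k))"
    by (induction k) (auto simp: orbit_shift_def add_ac)
  then show ?thesis by (simp add: orbit_proj0_def)
qed

lemma orbit_in_corr_iter:
  assumes "(z, \<gamma>) \<in> orbit_space \<Gamma>"
  shows "z (int k) \<in> corr_iter \<Gamma> k (z 0)"
proof (induction k)
  case (Suc k)
  have "\<gamma> (int (Suc k)) \<in> {1..ncomps \<Gamma>} \<and>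
        (z (int (Suc k) - 1), z (int (Suc k))) \<in> component \<Gamma> (\<gamma> (int (Suc k)))"
    using assms unfolding orbit_space_def by blast
  then have "z (int (Suc k)) \<in> corr_map \<Gamma> (z (int k))"
    unfolding corr_map_def support_def by auto
  then show ?case using Suc by auto
qed simp

text \<open>The visit of this one orbit to \<open>E\<close> is witnessed by a point of the k-th
  image of its starting point; other branches may reach \<open>E\<close> sooner, hence only an
  inequality.\<close>

lemma first_return_time_le:
  assumes "x \<in> orbit_space \<Gamma>" "1 \<le> k" "orbit_proj0 ((orbit_shift ^^ k) x) \<in> E"
  shows "first_return_time \<Gamma> E (orbit_proj0 x) \<le> enat k"
proof -
  obtain z \<gamma> where x: "x = (z, \<gamma>)" by (cases x)
  have "z (int k) \<in> corr_iter \<Gamma> k (z 0) \<inter> E"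
    using assms orbit_in_corr_iter by (auto simp: x orbit_proj0_shift_iter)
  then show ?thesis
    using assms(2) unfolding first_return_time_def
    by (intro Inf_lower) (auto simp: x orbit_proj0_def)
qed

theorem theorem5p1:
  fixes \<Gamma> :: correspondence and \<mu> :: "riemann_sphere measure" and E :: "riemann_sphere set"
  assumes "holomorphic_correspondence \<Gamma>"
    and "\<mu> \<in> ergodic_projections \<Gamma>"
    and "pullback_invariant \<Gamma> \<mu>"
    and "\<And>P. P \<in> sets borel \<Longrightarrow> polar_set P \<Longrightarrow> emeasure \<mu> P = 0"
    and "E \<in> sets borel"
    and "emeasure \<mu> E > 0"
  shows "(\<integral>\<^sup>+z\<in>E. ennreal_of_enat (first_return_time \<Gamma> E z) \<partial>uniform_measure \<mu> E)
           \<le> 1 / emeasure \<mu> E"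
proof (rule nn_integral_leI)
  obtain M where M: "M \<in> shift_invariant_measures \<Gamma>" and \<mu>: "\<mu> = distr M borel orbit_proj0"
    using assms(2) by (auto simp: ergodic_projections_def)
  have setsM: "sets M = sets (orbit_borel \<Gamma>)" and P: "prob_space M"
    and inv: "distr M M orbit_shift = M"
    using M by (auto simp: shift_invariant_measures_def)
  have spM: "space M = orbit_space \<Gamma>"
    using sets_eq_imp_space_eq[OF setsM] by (simp add: space_orbit_borel)
  have pr: "orbit_proj0 \<in> borel_measurable M"
    using measurable_orbit_proj0 measurable_cong_sets[OF setsM refl] by blast
  have sh: "orbit_shift \<in> measurable M M"
    using measurable_orbit_shift measurable_cong_sets[OF setsM setsM] by blast
  define A where "A = orbit_proj0 -` E \<inter> space M"
  have A: "A \<in> sets M" unfolding A_def using pr assms(5) by (rule measurable_sets)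
  \<comment> \<open>On \<open>A\<close> this is the return time to \<open>A\<close> under the
    shift.\<close>
  define R where "R x = (\<Sum>p. indicator {x \<in> A. \<forall>k\<in>{1..p}. (orbit_shift ^^ k) x \<notin> A} x :: ennreal)"
    for x
  have R: "ennreal_of_enat (first_return_time \<Gamma> E (orbit_proj0 x)) \<le> R x" if x: "x \<in> A" for x
    unfolding R_def
  proof (rule ennreal_of_enat_le_suminf)
    fix p assume p: "enat p < first_return_time \<Gamma> E (orbit_proj0 x)"
    have "x \<in> orbit_space \<Gamma>" using x by (simp add: A_def spM)
    \<comment> \<open>A visit at time k would bound the first return time by k \<le> p, against the
      choice of p.\<close>
    then have "(orbit_shift ^^ k) x \<notin> A" if "k \<in> {1..p}" for k
      using first_return_time_le[of x \<Gamma> k E] that p by (auto simp: A_def not_le[symmetric])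
        (meson enat_ord_simps(1) order_trans)
    then show "(1::ennreal) \<le> indicator {x \<in> A. \<forall>k\<in>{1..p}. (orbit_shift ^^ k) x \<notin> A} x"
      using x by simp
  qed
  \<comment> \<open>Both the formula for the normalized measure and the transport to the orbit space
    need a measurable integrand; they are applied to a measurable minorant \<open>s\<close> in place
    of the return time.\<close>
  fix s :: "riemann_sphere \<Rightarrow> ennreal"
  assume "s \<in> borel_measurable (uniform_measure \<mu> E)"
    and le: "s \<le> (\<lambda>z. ennreal_of_enat (first_return_time \<Gamma> E z) * indicator E z)"
  then have s: "s \<in> borel_measurable borel"
    by (simp add: \<mu> measurable_def)
  have "integral\<^sup>N (uniform_measure \<mu> E) s = (\<integral>\<^sup>+z. s z * indicator E z \<partial>\<mu>) / emeasure \<mu> E"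
    using s assms(5) by (intro nn_integral_uniform_measure) (auto simp: \<mu>)
  also have "(\<integral>\<^sup>+z. s z * indicator E z \<partial>\<mu>) = (\<integral>\<^sup>+x. s (orbit_proj0 x) * indicator E (orbit_proj0 x) \<partial>M)"
    unfolding \<mu> using s assms(5) pr by (intro nn_integral_distr) auto
  also have "\<dots> \<le> (\<integral>\<^sup>+x. R x \<partial>M)"
  proof (rule nn_integral_mono)
    fix x assume x: "x \<in> space M"
    show "s (orbit_proj0 x) * indicator E (orbit_proj0 x) \<le> R x"
    proof (cases "orbit_proj0 x \<in> E")
      case True
      then have "s (orbit_proj0 x) \<le> ennreal_of_enat (first_return_time \<Gamma> E (orbit_proj0 x))"
        using le_funD[OF le, of "orbit_proj0 x"] by simp
      also have "\<dots> \<le> R x" using True x by (intro R) (simp add: A_def)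
      finally show ?thesis using True by simp
    qed simp
  qed
  also have "\<dots> \<le> 1"
    unfolding R_def by (rule nn_integral_return_time_le[OF P sh inv A])
  finally show "integral\<^sup>N (uniform_measure \<mu> E) s \<le> 1 / emeasure \<mu> E"
    by (simp add: divide_right_mono_ennreal)
qed

end
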